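(* Let $(t_n)_{n\in\mathbb N_0}$ be natural numbers with $t_0>0$ and $t_n>\sum_{k=0}^{n-1}t_k$ for $n\in\mathbb N$, let $B=B(t_n)$ be the associated generalized Bratteli diagram with left-to-right order, and $\varphi_B$ its Vershik map. For $n\in\mathbb N$ put $P_n=t_n-\sum_{k=0}^{n-1}t_k$. Let $i\in V_0$ and let $[i,i-t_0]$ be the set of infinite paths whose first edge goes from $i\in V_0$ to $i-t_0\in V_1$; it decomposes as $[i,i-t_0]=\{\overline e_{\max}(i)\}\cup\bigsqcup_{n\ge1}C_n(i)$, where $\overline e_{\max}(i)$ is the infinite maximal path starting at $i$ and $C_n(i)=[x_0,\dots,x_{n-1},y_n]$ is the cylinder set of the finite path starting at $i$ whose first $n$ edges $x_0,\dots,x_{n-1}$ are left outgoing edges and whose last edge $y_n\in E_n$ is the right outgoing edge of $r(x_{n-1})$. Then $$\varphi_B([i,i-t_0])=\{\overline e_{\min}(i)\}\cup\bigsqcup_{n\ge1}D_n(i),$$ where $\overline e_{\min}(i)$ is the infinite minimal path starting at $i$ and, for $n\in\mathbb N$, $D_n(i)=[f_0,f_1,\dots,f_{n-1},z_n]$; here $r(z_n)=r(y_n)$ and $z_n$ is the successor of $y_n$, $s(z_n)=r(f_{n-1})$, and $(f_0,\dots,f_{n-1})$ is the minimal path connecting the vertex $i+2P_n\in V_0$ and $s(z_n)$.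
   Context: The diagram $B(t_n)$: $V_n=\mathbb Z$ for every $n\in\mathbb N_0$; each $i\in V_n$ has exactly two outgoing edges in $E_n$, the left one with range $i-t_n\in V_{n+1}$ and the right one with range $i+t_n\in V_{n+1}$. Thus each $j\in V_{n+1}$ has exactly two incoming edges, with sources $j-t_n$ and $j+t_n$ in $V_n$. Left-to-right order: on $r^{-1}(j)$ the edge from $j-t_n$ is minimal and the edge from $j+t_n$ is maximal (its successor). $X_B$ is the space of infinite paths $(x_n)_{n\ge0}$, $x_n\in E_n$, $r(x_n)=s(x_{n+1})$; $[x_0,\dots,x_m]$ is the cylinder set of infinite paths beginning with the given edges. A (finite or infinite) path is maximal (minimal) if all its edges are maximal (minimal); for each $i\in V_0$ there is exactly one infinite maximal path $\overline e_{\max}(i)$ (all left outgoing edges) and one infinite minimal path $\overline e_{\min}(i)$ (all right outgoing edges) starting at $i$. Vershik map $\varphi_B:X_B\to X_B$: if $x=(x_n)$ is not maximal and $m$ is the least index with $x_m$ not maximal, then $\varphi_B(x)=(g_0,\dots,g_{m-1},z,x_{m+1},x_{m+2},\dots)$, where $z$ is the successor of $x_m$ in $r^{-1}(r(x_m))$ and $(g_0,\dots,g_{m-1})$ is the minimal path from $V_0$ to $s(z)$; on maximal paths, $\varphi_B(\overline e_{\max}(i))=\overline e_{\min}(i)$. *)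

theory Defs
  imports Complex_Main "HOL-Library.Disjoint_Sets"
begin

text \<open>
  Every vertex set is a copy of the integers, so vertices are of type \<^typ>\<open>int\<close> and the level is
  understood from the context. An edge is a triple (level, source, range). In the diagrams
  considered here the shifts \<open>t n\<close> are positive, so there are no multiple edges and the triple
  determines the edge.
\<close>

type_synonym edge = "nat \<times> int \<times> int"

definition level :: "edge \<Rightarrow> nat" where "level e = fst e"
definition src :: "edge \<Rightarrow> int" where "src e = fst (snd e)"
definition rng :: "edge \<Rightarrow> int" where "rng e = snd (snd e)"

definition left_edge :: "(nat \<Rightarrow> nat) \<Rightarrow> nat \<Rightarrow> int \<Rightarrow> edge" where
  "left_edge t n i = (n, i, i - int (t n))"

definition right_edge :: "(nat \<Rightarrow> nat) \<Rightarrow> nat \<Rightarrow> int \<Rightarrow> edge" where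
  "right_edge t n i = (n, i, i + int (t n))"

definition edges :: "(nat \<Rightarrow> nat) \<Rightarrow> nat \<Rightarrow> edge set" where
  "edges t n = range (left_edge t n) \<union> range (right_edge t n)"

text \<open>
  The left-to-right order compares only edges with the same range (and level), by the position of
  their sources: on the incoming edges of \<open>j\<close> the edge from \<open>j - t n\<close> lies below the one from
  \<open>j + t n\<close>. The minimal edges are therefore the right outgoing ones.
\<close>

definition edge_less :: "edge \<Rightarrow> edge \<Rightarrow> bool" where
  "edge_less e e' \<longleftrightarrow> level e = level e' \<and> rng e = rng e' \<and> src e < src e'"

definition max_edge :: "(nat \<Rightarrow> nat) \<Rightarrow> nat \<Rightarrow> edge \<Rightarrow> bool" where
  "max_edge t n e \<longleftrightarrow> e \<in> edges t n \<and> \<not> (\<exists>e'\<in>edges t n. edge_less e e')"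

definition min_edge :: "(nat \<Rightarrow> nat) \<Rightarrow> nat \<Rightarrow> edge \<Rightarrow> bool" where
  "min_edge t n e \<longleftrightarrow> e \<in> edges t n \<and> \<not> (\<exists>e'\<in>edges t n. edge_less e' e)"

definition is_successor :: "(nat \<Rightarrow> nat) \<Rightarrow> nat \<Rightarrow> edge \<Rightarrow> edge \<Rightarrow> bool" where
  "is_successor t n e z \<longleftrightarrow> e \<in> edges t n \<and> z \<in> edges t n \<and> edge_less e z \<and>
     \<not> (\<exists>w\<in>edges t n. edge_less e w \<and> edge_less w z)"

definition successor :: "(nat \<Rightarrow> nat) \<Rightarrow> nat \<Rightarrow> edge \<Rightarrow> edge" where
  "successor t n e = (THE z. is_successor t n e z)"

definition path_space :: "(nat \<Rightarrow> nat) \<Rightarrow> (nat \<Rightarrow> edge) set" where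
  "path_space t = {x. \<forall>n. x n \<in> edges t n \<and> rng (x n) = src (x (Suc n))}"

text \<open>Finite paths start at level 0; the \<open>k\<close>-th entry of the list is the edge at level \<open>k\<close>.\<close>

definition finite_path :: "(nat \<Rightarrow> nat) \<Rightarrow> edge list \<Rightarrow> bool" where
  "finite_path t p \<longleftrightarrow> (\<forall>k<length p. p ! k \<in> edges t k) \<and>
     (\<forall>k. Suc k < length p \<longrightarrow> rng (p ! k) = src (p ! Suc k))"

definition cylinder :: "(nat \<Rightarrow> nat) \<Rightarrow> edge list \<Rightarrow> (nat \<Rightarrow> edge) set" where
  "cylinder t p = {x \<in> path_space t. \<forall>k<length p. x k = p ! k}"

text \<open>The final vertex of a finite path starting at \<open>i\<close>; for the empty path this is \<open>i\<close> itself.\<close>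

definition path_end :: "int \<Rightarrow> edge list \<Rightarrow> int" where
  "path_end i p = (if p = [] then i else rng (last p))"

text \<open>\<open>p\<close> is a minimal path of length \<open>n\<close> from the vertex \<open>i\<close> of level 0 to the vertex \<open>v\<close> of level \<open>n\<close>.\<close>

definition is_min_path :: "(nat \<Rightarrow> nat) \<Rightarrow> nat \<Rightarrow> int \<Rightarrow> int \<Rightarrow> edge list \<Rightarrow> bool" where
  "is_min_path t n i v p \<longleftrightarrow> finite_path t p \<and> length p = n \<and> (\<forall>k<n. min_edge t k (p ! k)) \<and>
     (p \<noteq> [] \<longrightarrow> src (hd p) = i) \<and> path_end i p = v"

definition max_path :: "(nat \<Rightarrow> nat) \<Rightarrow> (nat \<Rightarrow> edge) \<Rightarrow> bool" where
  "max_path t x \<longleftrightarrow> x \<in> path_space t \<and> (\<forall>n. max_edge t n (x n))"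

definition min_path :: "(nat \<Rightarrow> nat) \<Rightarrow> (nat \<Rightarrow> edge) \<Rightarrow> bool" where
  "min_path t x \<longleftrightarrow> x \<in> path_space t \<and> (\<forall>n. min_edge t n (x n))"

definition e_max :: "(nat \<Rightarrow> nat) \<Rightarrow> int \<Rightarrow> nat \<Rightarrow> edge" where
  "e_max t i = (THE x. max_path t x \<and> src (x 0) = i)"

definition e_min :: "(nat \<Rightarrow> nat) \<Rightarrow> int \<Rightarrow> nat \<Rightarrow> edge" where
  "e_min t i = (THE x. min_path t x \<and> src (x 0) = i)"

definition vershik :: "(nat \<Rightarrow> nat) \<Rightarrow> (nat \<Rightarrow> edge) \<Rightarrow> nat \<Rightarrow> edge" where
  "vershik t x =
     (if max_path t x then e_min t (src (x 0))
      else let m = (LEAST m. \<not> max_edge t m (x m));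
               z = successor t m (x m);
               g = (THE g. \<exists>i. is_min_path t m i (src z) g)
           in (\<lambda>n. if n < m then g ! n else if n = m then z else x n))"

definition P :: "(nat \<Rightarrow> nat) \<Rightarrow> nat \<Rightarrow> int" where
  "P t n = int (t n) - (\<Sum>k<n. int (t k))"

definition first_edge_set :: "(nat \<Rightarrow> nat) \<Rightarrow> int \<Rightarrow> int \<Rightarrow> (nat \<Rightarrow> edge) set" where
  "first_edge_set t i j = {x \<in> path_space t. src (x 0) = i \<and> rng (x 0) = j}"

text \<open>The path consisting of \<open>n\<close> left outgoing edges starting at the vertex \<open>i\<close> of level 0.\<close>

primrec left_path :: "(nat \<Rightarrow> nat) \<Rightarrow> int \<Rightarrow> nat \<Rightarrow> edge list" where
  "left_path t i 0 = []"
| "left_path t i (Suc n) = left_path t i n @ [left_edge t n (path_end i (left_path t i n))]"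

definition y_edge :: "(nat \<Rightarrow> nat) \<Rightarrow> int \<Rightarrow> nat \<Rightarrow> edge" where
  "y_edge t i n = right_edge t n (path_end i (left_path t i n))"

definition C :: "(nat \<Rightarrow> nat) \<Rightarrow> int \<Rightarrow> nat \<Rightarrow> (nat \<Rightarrow> edge) set" where
  "C t i n = cylinder t (left_path t i n @ [y_edge t i n])"

definition z_edge :: "(nat \<Rightarrow> nat) \<Rightarrow> int \<Rightarrow> nat \<Rightarrow> edge" where
  "z_edge t i n = successor t n (y_edge t i n)"

definition f_path :: "(nat \<Rightarrow> nat) \<Rightarrow> int \<Rightarrow> nat \<Rightarrow> edge list" where
  "f_path t i n = (THE f. is_min_path t n (i + 2 * P t n) (src (z_edge t i n)) f)"

definition D :: "(nat \<Rightarrow> nat) \<Rightarrow> int \<Rightarrow> nat \<Rightarrow> (nat \<Rightarrow> edge) set" where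
  "D t i n = cylinder t (f_path t i n @ [z_edge t i n])"

end

theory Submission
  imports Defs
begin

text \<open>
  Maximal edges are exactly the left outgoing ones and minimal edges the right outgoing ones, so
  along a maximal (minimal) path the vertex at level \<open>n\<close> is the initial one shifted by
  \<open>- (t 0 + \<dots> + t (n - 1))\<close> (by \<open>t 0 + \<dots> + t (n - 1)\<close>). A path in the cylinder \<open>C t i n\<close> makes its first
  right turn at level \<open>n\<close>; the successor of that edge starts at \<open>i - (t 0 + \<dots> + t (n - 1)) + 2 t n\<close>,
  and going back along right edges leads to \<open>i + 2 P t n\<close>. Since the tail is untouched, the
  Vershik map sends \<open>C t i n\<close> onto \<open>D t i n\<close>.
\<close>

section \<open>Edges, their order and successors\<close>

abbreviation shift_sum :: "(nat \<Rightarrow> nat) \<Rightarrow> nat \<Rightarrow> int" where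
  "shift_sum t n \<equiv> \<Sum>k<n. int (t k)"

lemma edge_simps [simp]:
  "level (left_edge t n v) = n" "src (left_edge t n v) = v" "rng (left_edge t n v) = v - int (t n)"
  "level (right_edge t n v) = n" "src (right_edge t n v) = v" "rng (right_edge t n v) = v + int (t n)"
  by (simp_all add: level_def src_def rng_def left_edge_def right_edge_def)

lemma edge_in_edges [simp]: "left_edge t n v \<in> edges t n" "right_edge t n v \<in> edges t n"
  by (simp_all add: edges_def)

lemma edges_cases:
  assumes "e \<in> edges t n"
  obtains (left) v where "e = left_edge t n v" | (right) v where "e = right_edge t n v"
  using assms by (auto simp: edges_def)

lemma left_edge_neq_right_edge:
  assumes "t n > 0"
  shows "left_edge t n v \<noteq> right_edge t n w" "right_edge t n w \<noteq> left_edge t n v"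
  using assms by (auto simp: left_edge_def right_edge_def)

lemma bex_edges_iff:
  "(\<exists>e\<in>edges t n. Q e) \<longleftrightarrow> (\<exists>v. Q (left_edge t n v)) \<or> (\<exists>v. Q (right_edge t n v))"
  by (auto simp: edges_def)

text \<open>The right edge from \<open>v\<close> and the left edge from
  \<open>v + 2 * int (t n)\<close> share their range, and positivity of \<open>t n\<close> puts the
  left one strictly above. Nothing lies above a left edge, since the other edge into its range has a
  smaller source.\<close>

lemma max_edge_iff:
  assumes "t n > 0"
  shows "max_edge t n e \<longleftrightarrow> e = left_edge t n (src e)"
proof
  assume m: "max_edge t n e"
  then have "e \<in> edges t n" by (simp add: max_edge_def)
  then show "e = left_edge t n (src e)"
  proof (cases rule: edges_cases)
    case (right v)
    then have "edge_less e (left_edge t n (v + 2 * int (t n)))"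
      using assms by (simp add: edge_less_def)
    then show ?thesis using m edge_in_edges unfolding max_edge_def by blast
  qed simp
next
  assume "e = left_edge t n (src e)"
  then obtain v where "e = left_edge t n v" ..
  then show "max_edge t n e"
    using assms by (auto simp: max_edge_def bex_edges_iff edge_less_def)
qed

lemma min_edge_iff:
  assumes "t n > 0"
  shows "min_edge t n e \<longleftrightarrow> e = right_edge t n (src e)"
proof
  assume m: "min_edge t n e"
  then have "e \<in> edges t n" by (simp add: min_edge_def)
  then show "e = right_edge t n (src e)"
  proof (cases rule: edges_cases)
    case (left v)
    \<comment> \<open>The left edge from \<open>v\<close> ends at \<open>v - t n\<close>; the right
      edge into that vertex starts another \<open>t n\<close> further left.\<close>
    then have "edge_less (right_edge t n (v - 2 * int (t n))) e"
      using assms by (simp add: edge_less_def)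
    then show ?thesis using m edge_in_edges unfolding min_edge_def by blast
  qed simp
next
  assume "e = right_edge t n (src e)"
  then obtain v where "e = right_edge t n v" ..
  then show "min_edge t n e"
    using assms by (auto simp: min_edge_def bex_edges_iff edge_less_def)
qed

text \<open>A vertex has only two incoming edges, so nothing fits between them. The equivalence
  yields both unique existence and the value of the description in \<open>successor\<close>.\<close>

lemma is_successor_right_edge_iff:
  assumes "t n > 0"
  shows "is_successor t n (right_edge t n v) z \<longleftrightarrow> z = left_edge t n (v + 2 * int (t n))"
proof
  assume s: "is_successor t n (right_edge t n v) z"
  then have "z \<in> edges t n" and l: "edge_less (right_edge t n v) z" by (auto simp: is_successor_def)
  then show "z = left_edge t n (v + 2 * int (t n))"
    by (cases rule: edges_cases) (auto simp: edge_less_def add.commute)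
next
  assume "z = left_edge t n (v + 2 * int (t n))"
  then show "is_successor t n (right_edge t n v) z"
    using assms by (auto simp: is_successor_def bex_edges_iff edge_less_def)
qed

lemma successor_right_edge:
  assumes "t n > 0"
  shows "successor t n (right_edge t n v) = left_edge t n (v + 2 * int (t n))"
  using assms by (simp add: successor_def is_successor_right_edge_iff)

section \<open>Vertices along paths and the extremal paths\<close>

text \<open>Common telescoping argument for runs of left edges (\<open>d k\<close> negative) and
  right edges (\<open>d k\<close> positive). The bound \<open>m\<close> lets it serve infinite
  paths, initial segments and lists alike.\<close>

lemma src_along_path:
  assumes "\<And>k. k < m \<Longrightarrow> rng (x k) = src (x k) + d k"
    and "\<And>k. k < m \<Longrightarrow> rng (x k) = src (x (Suc k))"
  shows "src (x m) = src (x 0) + (\<Sum>k<m. d k)"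
  using assms by (induction m) (auto simp: algebra_simps less_Suc_eq)

lemma left_edges_from_start:
  assumes "\<And>k. k < m \<Longrightarrow> x k = left_edge t k (src (x k))"
    and "\<And>k. k < m \<Longrightarrow> rng (x k) = src (x (Suc k))"
  shows "src (x m) = src (x 0) - shift_sum t m"
proof -
  have "src (x m) = src (x 0) + (\<Sum>k<m. - int (t k))"
  proof (rule src_along_path)
    fix k assume "k < m"
    \<comment> \<open>The equation for \<open>x k\<close> has \<open>x k\<close> on its right side
      and would loop as a rewrite rule, so only its range is extracted.\<close>
    with assms(1) have "rng (x k) = rng (left_edge t k (src (x k)))" by metis
    then show "rng (x k) = src (x k) + - int (t k)" by simp
  qed (use assms(2) in auto)
  then show ?thesis by (simp add: sum_negf)
qed

lemma right_edges_from_start: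
  assumes "\<And>k. k < m \<Longrightarrow> x k = right_edge t k (src (x k))"
    and "\<And>k. k < m \<Longrightarrow> rng (x k) = src (x (Suc k))"
  shows "src (x m) = src (x 0) + shift_sum t m"
proof (rule src_along_path)
  fix k assume "k < m"
  with assms(1) have "rng (x k) = rng (right_edge t k (src (x k)))" by metis
  then show "rng (x k) = src (x k) + int (t k)" by simp
qed (use assms(2) in auto)

lemma path_spaceD:
  assumes "x \<in> path_space t"
  shows "x n \<in> edges t n" "rng (x n) = src (x (Suc n))"
  using assms by (auto simp: path_space_def)

text \<open>The edges are forced to be left ones and the start fixes all vertices. An explicit
  solution gives existence and uniqueness at once, which evaluates the description in
  \<open>e_max\<close>.\<close>

lemma max_path_iff:
  assumes pos: "\<And>n. t n > 0"
  shows "max_path t x \<and> src (x 0) = i \<longleftrightarrow> x = (\<lambda>k. left_edge t k (i - shift_sum t k))"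
proof
  assume a: "max_path t x \<and> src (x 0) = i"
  then have l: "x k = left_edge t k (src (x k))" for k
    using max_edge_iff[of t, OF pos] by (auto simp: max_path_def)
  moreover have "src (x k) = i - shift_sum t k" for k
    using left_edges_from_start[of k x t] a l path_spaceD by (auto simp: max_path_def)
  ultimately show "x = (\<lambda>k. left_edge t k (i - shift_sum t k))" by metis
next
  assume "x = (\<lambda>k. left_edge t k (i - shift_sum t k))"
  then show "max_path t x \<and> src (x 0) = i"
    by (auto simp: max_path_def path_space_def max_edge_iff pos)
qed

lemma min_path_iff:
  assumes pos: "\<And>n. t n > 0"
  shows "min_path t x \<and> src (x 0) = i \<longleftrightarrow> x = (\<lambda>k. right_edge t k (i + shift_sum t k))"
proof
  assume a: "min_path t x \<and> src (x 0) = i"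
  then have l: "x k = right_edge t k (src (x k))" for k
    using min_edge_iff[of t, OF pos] by (auto simp: min_path_def)
  moreover have "src (x k) = i + shift_sum t k" for k
    using right_edges_from_start[of k x t] a l path_spaceD by (auto simp: min_path_def)
  ultimately show "x = (\<lambda>k. right_edge t k (i + shift_sum t k))" by metis
next
  assume "x = (\<lambda>k. right_edge t k (i + shift_sum t k))"
  then show "min_path t x \<and> src (x 0) = i"
    by (auto simp: min_path_def path_space_def min_edge_iff pos)
qed

lemma e_max_eq:
  assumes "\<And>n. t n > 0"
  shows "e_max t i = (\<lambda>k. left_edge t k (i - shift_sum t k))"
  unfolding e_max_def max_path_iff[of t, OF assms] by simp

lemma e_min_eq:
  assumes "\<And>n. t n > 0"
  shows "e_min t i = (\<lambda>k. right_edge t k (i + shift_sum t k))"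
  unfolding e_min_def min_path_iff[of t, OF assms] by simp

text \<open>Each right edge shifts by a fixed amount, so either end vertex determines the other and
  the whole path. This makes the description in \<open>vershik\<close>, which leaves the start open,
  well defined.\<close>

lemma is_min_path_iff:
  assumes pos: "\<And>n. t n > 0"
  shows "is_min_path t n i v p \<longleftrightarrow>
    p = map (\<lambda>k. right_edge t k (i + shift_sum t k)) [0..<n] \<and> v = i + shift_sum t n"
    (is "?L \<longleftrightarrow> p = ?p \<and> _")
proof
  assume a: ?L
  have len: "length p = n" using a by (simp add: is_min_path_def)
  have l: "p ! k = right_edge t k (src (p ! k))" if "k < n" for k
    using a that min_edge_iff[of t, OF pos] by (auto simp: is_min_path_def)
  have s: "src (p ! k) = i + shift_sum t k" if "k < n" for k
  proof -
    have "src (p ! k) = src (p ! 0) + shift_sum t k"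
      using a that l by (intro right_edges_from_start) (auto simp: is_min_path_def finite_path_def)
    moreover have "src (p ! 0) = i"
      using a that by (auto simp: is_min_path_def hd_conv_nth)
    ultimately show ?thesis by simp
  qed
  have p: "p = ?p"
  proof (rule nth_equalityI)
    fix k assume "k < length p"
    with len l[of k] s[of k] show "p ! k = ?p ! k" by simp
  qed (simp add: len)
  moreover have "v = i + shift_sum t n"
    \<comment> \<open>For \<open>n = 0\<close> the path is empty and \<open>path_end\<close> returns
      \<open>i\<close>; otherwise the last edge has index \<open>n - 1\<close> and its range
      supplies the last summand.\<close>
    using a unfolding p by (cases n) (auto simp: is_min_path_def path_end_def last_conv_nth simp del: upt_Suc)
  ultimately show "p = ?p \<and> v = i + shift_sum t n" by simp
next
  assume "p = ?p \<and> v = i + shift_sum t n"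
  then show ?L
    by (cases n)
      (auto simp: is_min_path_def finite_path_def min_edge_iff pos path_end_def hd_conv_nth
        last_conv_nth simp del: upt_Suc)
qed

section \<open>Explicit coordinates for the two families of cylinders\<close>

lemma left_path_eq: "left_path t i n = map (\<lambda>k. left_edge t k (i - shift_sum t k)) [0..<n]"
  and path_end_left_path: "path_end i (left_path t i n) = i - shift_sum t n"
  by (induction n) (auto simp: path_end_def)

lemma y_edge_eq: "y_edge t i n = right_edge t n (i - shift_sum t n)"
  by (simp add: y_edge_def path_end_left_path)

text \<open>The successor starts at \<open>i - shift_sum t n + 2 * int (t n)\<close>. Rewritten
  through \<open>P\<close>, this is the vertex reached by \<open>n\<close> right edges from
  \<open>i + 2 * P t n\<close>, which is why that start vertex occurs in
  \<open>f_path\<close>.\<close>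

lemma z_edge_eq:
  assumes "t n > 0"
  shows "z_edge t i n = left_edge t n (i + 2 * P t n + shift_sum t n)"
  using assms by (simp add: z_edge_def y_edge_eq successor_right_edge P_def algebra_simps)

lemma f_path_eq:
  assumes "\<And>n. t n > 0"
  shows "f_path t i n = map (\<lambda>k. right_edge t k (i + 2 * P t n + shift_sum t k)) [0..<n]"
  using assms by (simp add: f_path_def is_min_path_iff z_edge_eq)

lemma cylinder_snoc_iff:
  "x \<in> cylinder t (map f [0..<n] @ [e]) \<longleftrightarrow> x \<in> path_space t \<and> (\<forall>k<n. x k = f k) \<and> x n = e"
  by (auto simp: cylinder_def nth_append less_Suc_eq)

lemma mem_C_iff:
  "x \<in> C t i n \<longleftrightarrow> x \<in> path_space t \<and> (\<forall>k<n. x k = left_edge t k (i - shift_sum t k)) \<and>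
    x n = right_edge t n (i - shift_sum t n)"
  by (simp add: C_def left_path_eq y_edge_eq cylinder_snoc_iff)

lemma mem_D_iff:
  assumes "\<And>n. t n > 0"
  shows "x \<in> D t i n \<longleftrightarrow> x \<in> path_space t \<and>
    (\<forall>k<n. x k = right_edge t k (i + 2 * P t n + shift_sum t k)) \<and>
    x n = left_edge t n (i + 2 * P t n + shift_sum t n)"
  using assms by (simp add: D_def f_path_eq z_edge_eq cylinder_snoc_iff)

section \<open>Disjointness and the decomposition of the first-edge set\<close>

text \<open>The index is read off a path as the level of its first right edge.\<close>

lemma disjoint_family_C:
  assumes "\<And>n. t n > 0"
  shows "disjoint_family_on (C t i) N"
proof -
  have "x \<notin> C t i m" if "x \<in> C t i n" "n < m" for x n m
    using that by (auto simp: mem_C_iff left_edge_neq_right_edge assms)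
  then show ?thesis
    unfolding disjoint_family_on_def by (metis disjoint_iff linorder_neqE_nat)
qed

text \<open>Here the index is the level of the first left edge.\<close>

lemma disjoint_family_D:
  assumes "\<And>n. t n > 0"
  shows "disjoint_family_on (D t i) N"
proof -
  have "x \<notin> D t i m" if "x \<in> D t i n" "n < m" for x n m
    using that by (auto simp: mem_D_iff left_edge_neq_right_edge assms)
  then show ?thesis
    unfolding disjoint_family_on_def by (metis disjoint_iff linorder_neqE_nat)
qed

lemma first_edge_set_eq:
  assumes pos: "\<And>n. t n > 0"
  shows "first_edge_set t i (i - int (t 0)) = {e_max t i} \<union> (\<Union>n\<in>{1..}. C t i n)" (is "?L = ?R")
proof
  show "?R \<subseteq> ?L"
  proof
    fix x assume "x \<in> ?R"
    then consider "x = e_max t i" | n where "n \<ge> 1" "x \<in> C t i n" by auto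
    then show "x \<in> ?L"
    proof cases
      case 1
      then have "max_path t x" using max_path_iff[of t, OF pos] e_max_eq[of t, OF pos] by metis
      then show ?thesis using 1 by (simp add: first_edge_set_def max_path_def e_max_eq[of t, OF pos])
    next
      case 2
      then have "x 0 = left_edge t 0 i" by (simp add: mem_C_iff)
      then show ?thesis using 2 by (simp add: first_edge_set_def mem_C_iff)
    qed
  qed
  show "?L \<subseteq> ?R"
  proof
    fix x assume x: "x \<in> ?L"
    then have path: "x \<in> path_space t" and s0: "src (x 0) = i" and r0: "rng (x 0) = i - int (t 0)"
      by (auto simp: first_edge_set_def)
    show "x \<in> ?R"
    proof (cases "max_path t x")
      case True
      then have "x = e_max t i" using s0 max_path_iff[of t, OF pos] e_max_eq[of t, OF pos] by metis
      then show ?thesis by simp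
    next
      case False
      \<comment> \<open>The index of the piece containing \<open>x\<close> is the level of its first
        right edge.\<close>
      define m where "m = (LEAST m. \<not> max_edge t m (x m))"
      from False path have ex: "\<exists>m. \<not> max_edge t m (x m)" by (auto simp: max_path_def)
      have "\<not> max_edge t m (x m)" using ex unfolding m_def by (rule LeastI_ex)
      then have xm: "x m = right_edge t m (src (x m))"
        using path_spaceD(1)[OF path, of m] by (auto elim: edges_cases simp: max_edge_iff pos)
      have left: "x k = left_edge t k (src (x k))" if "k < m" for k
        using not_less_Least[of k "\<lambda>m. \<not> max_edge t m (x m)"] that
        by (auto simp: m_def max_edge_iff pos)
      have src: "src (x k) = i - shift_sum t k" if "k \<le> m" for k
        using left_edges_from_start[of k x t] left path_spaceD(2)[OF path] s0 that by auto
      have "m \<noteq> 0"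
      proof
        assume "m = 0"
        \<comment> \<open>A right edge at level 0 would end at \<open>i + t 0\<close> instead of
          \<open>i - t 0\<close>.\<close>
        with xm s0 have "rng (x 0) = rng (right_edge t 0 i)" by simp
        with r0 pos[of 0] show False by simp
      qed
      moreover have "x \<in> C t i m"
        unfolding mem_C_iff using path left xm src by (metis less_imp_le order_refl)
      ultimately show ?thesis by auto
    qed
  qed
qed

lemma e_max_notin_C:
  assumes "\<And>n. t n > 0"
  shows "e_max t i \<notin> C t i n"
  by (simp add: mem_C_iff e_max_eq left_edge_neq_right_edge assms)

lemma e_min_notin_D:
  assumes "\<And>n. t n > 0"
  shows "e_min t i \<notin> D t i n"
  by (simp add: mem_D_iff e_min_eq left_edge_neq_right_edge assms)

section \<open>The Vershik map on the pieces\<close>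

lemma vershik_e_max:
  assumes "\<And>n. t n > 0"
  shows "vershik t (e_max t i) = e_min t i"
proof -
  have "max_path t (e_max t i) \<and> src (e_max t i 0) = i"
    using max_path_iff[of t, OF assms] e_max_eq[of t, OF assms] by metis
  then show ?thesis by (simp add: vershik_def)
qed

lemma vershik_on_C:
  assumes pos: "\<And>n. t n > 0" and x: "x \<in> C t i n"
  shows "vershik t x = (\<lambda>k. if k < n then right_edge t k (i + 2 * P t n + shift_sum t k)
    else if k = n then left_edge t n (i + 2 * P t n + shift_sum t n) else x k)"
proof -
  have nmax: "\<not> max_edge t n (x n)"
    using x by (simp add: mem_C_iff max_edge_iff pos left_edge_neq_right_edge)
  then have "\<not> max_path t x" by (auto simp: max_path_def)
  moreover have "(LEAST m. \<not> max_edge t m (x m)) = n"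
  proof (rule Least_equality[where P = "\<lambda>m. \<not> max_edge t m (x m)", OF nmax])
    fix m assume "\<not> max_edge t m (x m)"
    then show "n \<le> m" using x by (intro leI notI) (simp add: mem_C_iff max_edge_iff pos)
  qed
  moreover have "successor t n (x n) = left_edge t n (i + 2 * P t n + shift_sum t n)"
    using x pos by (simp add: z_edge_eq z_edge_def[symmetric] y_edge_eq[symmetric] mem_C_iff)
  \<comment> \<open>The existential start vertex is forced to be \<open>i + 2 * P t n\<close> by the
    prescribed end vertex.\<close>
  moreover have "(THE g. \<exists>j. is_min_path t n j (i + 2 * P t n + shift_sum t n) g)
      = map (\<lambda>k. right_edge t k (i + 2 * P t n + shift_sum t k)) [0..<n]"
    by (simp add: is_min_path_iff pos)
  ultimately show ?thesis by (auto simp: vershik_def Let_def)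
qed

lemma vershik_image_C:
  assumes pos: "\<And>n. t n > 0"
  shows "vershik t ` C t i n = D t i n"
proof
  let ?q = "i + 2 * P t n"
  \<comment> \<open>The old right edge and the new left edge at level \<open>n\<close> end at the
    same vertex, so either can be followed by the same tail.\<close>
  have q: "?q + shift_sum t n - int (t n) = i - shift_sum t n + int (t n)"
    by (simp add: P_def)
  show "vershik t ` C t i n \<subseteq> D t i n"
  proof
    fix y assume "y \<in> vershik t ` C t i n"
    then obtain x where x: "x \<in> C t i n" and y: "y = vershik t x" by auto
    have path: "x \<in> path_space t" and "x n = right_edge t n (i - shift_sum t n)"
      using x by (auto simp: mem_C_iff)
    then have "src (x (Suc n)) = i - shift_sum t n + int (t n)"
      using path_spaceD(2)[OF path, of n] by simp
    then have "rng (y k) = src (y (Suc k))" for k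
      using path_spaceD(2)[OF path] q
      by (cases k n rule: linorder_cases) (auto simp: y vershik_on_C[of t, OF pos x] not_less_eq less_Suc_eq)
    moreover have "y k \<in> edges t k" for k
      using path_spaceD(1)[OF path] by (simp add: y vershik_on_C[of t, OF pos x])
    ultimately show "y \<in> D t i n"
      unfolding mem_D_iff[of t, OF pos] by (simp add: path_space_def) (simp add: y vershik_on_C[of t, OF pos x])
  qed
  show "D t i n \<subseteq> vershik t ` C t i n"
  proof
    fix y assume y: "y \<in> D t i n"
    \<comment> \<open>The preimage keeps the tail of \<open>y\<close> after level \<open>n\<close>
      and replaces the initial edges by those defining \<open>C t i n\<close>.\<close>
    define x where "x = (\<lambda>k. if k < n then left_edge t k (i - shift_sum t k)
      else if k = n then right_edge t n (i - shift_sum t n) else y k)"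
    have path: "y \<in> path_space t" and "y n = left_edge t n (?q + shift_sum t n)"
      using y by (auto simp: mem_D_iff pos)
    then have "src (y (Suc n)) = i - shift_sum t n + int (t n)"
      using path_spaceD(2)[OF path, of n] q by simp
    then have "rng (x k) = src (x (Suc k))" for k
      using path_spaceD(2)[OF path]
      by (cases k n rule: linorder_cases; cases "Suc k = n") (auto simp: x_def)
    moreover have "x k \<in> edges t k" for k
      using path_spaceD(1)[OF path] by (simp add: x_def)
    ultimately have x: "x \<in> C t i n"
      unfolding mem_C_iff by (simp add: path_space_def) (simp add: x_def)
    have "vershik t x = y"
      unfolding vershik_on_C[of t, OF pos x] using y by (auto simp: mem_D_iff pos x_def)
    with x show "y \<in> vershik t ` C t i n" by blast
  qed
qed

theorem theorem7p7:
  fixes t :: "nat \<Rightarrow> nat" and i :: int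
  assumes "t 0 > 0"
    and "\<And>n. n \<ge> 1 \<Longrightarrow> t n > (\<Sum>k<n. t k)"
  shows "(\<exists>!x. max_path t x \<and> src (x 0) = i)
      \<and> (\<exists>!x. min_path t x \<and> src (x 0) = i)
      \<and> first_edge_set t i (i - int (t 0)) = {e_max t i} \<union> (\<Union>n\<in>{1..}. C t i n)
      \<and> e_max t i \<notin> (\<Union>n\<in>{1..}. C t i n)
      \<and> disjoint_family_on (C t i) {1..}
      \<and> (\<forall>n\<ge>1. (\<exists>!z. is_successor t n (y_edge t i n) z)
           \<and> rng (z_edge t i n) = rng (y_edge t i n)
           \<and> (\<exists>!f. is_min_path t n (i + 2 * P t n) (src (z_edge t i n)) f))
      \<and> vershik t ` first_edge_set t i (i - int (t 0)) = {e_min t i} \<union> (\<Union>n\<in>{1..}. D t i n)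
      \<and> e_min t i \<notin> (\<Union>n\<in>{1..}. D t i n)
      \<and> disjoint_family_on (D t i) {1..}"
proof -
  \<comment> \<open>For \<open>n \<ge> 1\<close> the strict lower bound is a sum of naturals, hence
    nonnegative; level 0 is the first assumption.\<close>
  have pos: "t n > 0" for n
    using assms by (cases "n = 0") (auto simp: Suc_le_eq intro: le_less_trans)
  show ?thesis
  proof (intro conjI allI impI)
    show "\<exists>!x. max_path t x \<and> src (x 0) = i"
      unfolding max_path_iff[of t, OF pos] by simp
    show "\<exists>!x. min_path t x \<and> src (x 0) = i"
      unfolding min_path_iff[of t, OF pos] by simp
    \<comment> \<open>Images commute with unions, so the image is assembled from the decomposition
      piece by piece.\<close>
    show "vershik t ` first_edge_set t i (i - int (t 0)) = {e_min t i} \<union> (\<Union>n\<in>{1..}. D t i n)"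
      by (simp add: first_edge_set_eq pos image_Un image_UN vershik_e_max vershik_image_C)
  next
    fix n :: nat
    show "\<exists>!z. is_successor t n (y_edge t i n) z"
      by (simp add: y_edge_eq is_successor_right_edge_iff pos)
    show "rng (z_edge t i n) = rng (y_edge t i n)"
      by (simp add: y_edge_eq z_edge_eq pos P_def)
    show "\<exists>!f. is_min_path t n (i + 2 * P t n) (src (z_edge t i n)) f"
      by (simp add: is_min_path_iff z_edge_eq pos)
  qed (simp_all add: first_edge_set_eq e_max_notin_C e_min_notin_D disjoint_family_C
      disjoint_family_D pos)
qed

end
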